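(* Let $\pi:M\to\mathbb{L}_+$ be a principal $\mathbb{S}^1$-bundle over the long ray. Then $M$ contains a copy of $\omega_1$ if and only if $M$ is of order $1$.
   Context: A copy of $\omega_1$ is a subspace homeomorphic to $\omega_1$ with the order topology. The long ray $\mathbb{L}_+$ is $\omega_1\times[0,1)$ with lexicographic order topology and smallest point removed; nonzero ordinals are identified with the points $\alpha+0$ of $\mathbb{L}_+$ (clubs of $\omega_1$ used as subsets of $\mathbb{L}_+$ do not contain $0$). $\mathbb{S}^1$ is the reals modulo $2\pi$. A principal $\mathbb{S}^1$-bundle $\pi:M\to\mathbb{L}_+$ is a locally trivial bundle with fiber $\mathbb{S}^1$ together with a continuous action of $\mathbb{S}^1$ on $M$ leaving each fiber $M_p=\pi^{-1}(\{p\})$ invariant and free and transitive on fibers; $x+\theta$ is the image of $x$ under the action of $\theta$. A subset of $M$ is unbounded if its image under $\pi$ is unbounded in $\mathbb{L}_+$; club means closed and unbounded. $M$ is of order $\infty$ if for every club $F\subset M$ there is a club $C\subset\omega_1$ with $\pi^{-1}(C)\subset F$. Otherwise the order of $M$ is the least $n\ge1$ for which there are a club $E\subset M$ and a club $C\subset\omega_1$ such that for every $\alpha\in C$, $|E\cap M_\alpha|=n$ and $E\cap M_\alpha=\{x+\frac{2\pi k}{n}:k=0,\dots,n-1\}$ for each $x\in E\cap M_\alpha$. *)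

theory Defs
  imports "HOL-Analysis.Analysis" "HOL-Library.Real_Mod" "HOL-Library.Extended_Nat"
begin

section \<open>The first uncountable ordinal\<close>

text \<open>A cardinal is an initial ordinal, so the well-order \<open>cardSuc natLeq\<close> on its field has
  order type \<open>\<omega>\<^sub>1\<close>; see \<open>uncountable_omega1\<close> and \<open>countable_lessThan_omega1\<close> below.\<close>

lemma Card_order_omega1: "Card_order (cardSuc natLeq)"
  by (rule cardSuc_Card_order[OF natLeq_Card_order])

lemma Well_order_omega1: "Well_order (cardSuc natLeq)"
  using Card_order_omega1 by (simp add: card_order_on_well_order_on)

lemma infinite_Field_omega1: "infinite (Field (cardSuc natLeq))"
  using cardSuc_finite[OF natLeq_Card_order] by (simp add: Field_natLeq)

typedef omega1 = "Field (cardSuc natLeq)"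
  using infinite_Field_omega1 by (auto intro: ccontr simp: finite.emptyI)

instantiation omega1 :: linorder
begin

definition less_eq_omega1 :: "omega1 \<Rightarrow> omega1 \<Rightarrow> bool" where
  "x \<le> y \<longleftrightarrow> (Rep_omega1 x, Rep_omega1 y) \<in> cardSuc natLeq"

definition less_omega1 :: "omega1 \<Rightarrow> omega1 \<Rightarrow> bool" where
  "x < y \<longleftrightarrow> x \<le> y \<and> x \<noteq> (y :: omega1)"

instance
proof
  have lin: "Linear_order (cardSuc natLeq)"
    using Well_order_omega1 by (simp add: well_order_on_def)
  then have refl: "Refl (cardSuc natLeq)" and tr: "trans (cardSuc natLeq)"
    and anti: "antisym (cardSuc natLeq)" and tot: "Total (cardSuc natLeq)"
    by (auto simp: linear_order_on_def partial_order_on_def preorder_on_def)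
  fix x y z :: omega1
  show le_refl: "x \<le> x"
    using refl Rep_omega1 by (auto simp: less_eq_omega1_def refl_on_def)
  show "x \<le> y \<Longrightarrow> y \<le> z \<Longrightarrow> x \<le> z"
    using tr by (auto simp: less_eq_omega1_def trans_def)
  show le_anti: "x \<le> y \<Longrightarrow> y \<le> x \<Longrightarrow> x = y" for x y :: omega1
    using anti unfolding less_eq_omega1_def by (metis antisymD Rep_omega1_inject)
  show "x \<le> y \<or> y \<le> x"
  proof (cases "x = y")
    case False
    then show ?thesis
      using tot Rep_omega1 Rep_omega1_inject unfolding less_eq_omega1_def total_on_def by metis
  qed (use le_refl in auto)
  show "x < y \<longleftrightarrow> x \<le> y \<and> \<not> y \<le> x"
    using le_anti le_refl by (auto simp: less_omega1_def)
qed

end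

lemma wf_omega1: "wf {(x, y). x < (y :: omega1)}"
proof -
  have "wf (inv_image (cardSuc natLeq - Id) Rep_omega1)"
    using Well_order_omega1 by (intro wf_inv_image) (simp add: well_order_on_def)
  moreover have "inv_image (cardSuc natLeq - Id) Rep_omega1 = {(x, y). x < (y :: omega1)}"
    by (auto simp: inv_image_def less_omega1_def less_eq_omega1_def Rep_omega1_inject)
  ultimately show ?thesis by simp
qed

instance omega1 :: wellorder
proof
  fix P :: "omega1 \<Rightarrow> bool" and a
  assume *: "\<And>x. (\<And>y. y < x \<Longrightarrow> P y) \<Longrightarrow> P x"
  show "P a"
    using wf_omega1 by (induction a rule: wf_induct_rule) (auto intro: *)
qed

instantiation omega1 :: order_bot
begin

definition bot_omega1 :: omega1 where "bot = (LEAST x :: omega1. True)"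

instance
  by standard (simp add: bot_omega1_def Least_le)

end

instantiation omega1 :: linorder_topology
begin

definition open_omega1 :: "omega1 set \<Rightarrow> bool" where
  "open_omega1 = generate_topology (range (\<lambda>a. {..< a}) \<union> range (\<lambda>a. {a <..}))"

instance
  by standard (rule open_omega1_def)

end

lemma uncountable_omega1: "uncountable (UNIV :: omega1 set)"
proof
  assume "countable (UNIV :: omega1 set)"
  then have "countable (range Rep_omega1)"
    by (rule countable_image)
  then have "countable (Field (cardSuc natLeq))"
    using type_definition.Rep_range[OF type_definition_omega1] by simp
  then obtain f :: "nat set \<Rightarrow> nat" where "inj_on f (Field (cardSuc natLeq))"
    by (auto simp: countable_def)
  then have "ordLeq3 (card_of (Field (cardSuc natLeq))) (card_of (UNIV :: nat set))"
    by (intro iffD1[OF card_of_ordLeq]) auto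
  moreover have "ordIso2 (card_of (Field (cardSuc natLeq))) (cardSuc natLeq)"
    by (rule card_of_Field_ordIso[OF Card_order_omega1])
  moreover have "ordIso2 (card_of (UNIV :: nat set)) natLeq"
    by (rule card_of_nat)
  ultimately have "ordLeq3 (cardSuc natLeq) natLeq"
    using ordIso_ordLeq_trans ordIso_symmetric ordLeq_ordIso_trans by blast
  then show False
    using cardSuc_greater[OF natLeq_Card_order] not_ordLess_ordLeq by blast
qed

lemma countable_lessThan_omega1: "countable {..<a :: omega1}"
proof -
  let ?U = "Order_Relation.underS (cardSuc natLeq) (Rep_omega1 a)"
  have "ordLess2 (card_of ?U) (cardSuc natLeq)"
    by (rule card_of_underS[OF Card_order_omega1 Rep_omega1])
  then have "ordLeq3 (card_of ?U) natLeq"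
    using cardSuc_ordLeq_ordLess[OF natLeq_Card_order card_of_Card_order] by blast
  then have "ordLeq3 (card_of ?U) (card_of (UNIV :: nat set))"
    using card_of_nat ordIso_symmetric ordLeq_ordIso_trans by blast
  then have "countable ?U"
    unfolding countable_def card_of_ordLeq[symmetric] by blast
  moreover have "Rep_omega1 ` {..<a} \<subseteq> ?U"
    by (auto simp: Order_Relation.underS_def less_omega1_def less_eq_omega1_def Rep_omega1_inject)
  ultimately have "countable (Rep_omega1 ` {..<a})"
    using countable_subset by blast
  then show ?thesis
    by (rule countable_image_inj_on) (simp add: inj_on_def Rep_omega1_inject)
qed


section \<open>The long ray\<close>

typedef closed_long_ray = "UNIV \<times> {0..<1} :: (omega1 \<times> real) set"
  by (rule exI[of _ "(bot, 0)"]) simp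

instantiation closed_long_ray :: linorder
begin

definition less_eq_closed_long_ray :: "closed_long_ray \<Rightarrow> closed_long_ray \<Rightarrow> bool" where
  "x \<le> y \<longleftrightarrow>
     fst (Rep_closed_long_ray x) < fst (Rep_closed_long_ray y) \<or>
     fst (Rep_closed_long_ray x) = fst (Rep_closed_long_ray y) \<and>
     snd (Rep_closed_long_ray x) \<le> snd (Rep_closed_long_ray y)"

definition less_closed_long_ray :: "closed_long_ray \<Rightarrow> closed_long_ray \<Rightarrow> bool" where
  "x < y \<longleftrightarrow> x \<le> y \<and> \<not> y \<le> (x :: closed_long_ray)"

instance
  by standard (auto simp: less_eq_closed_long_ray_def less_closed_long_ray_def prod_eq_iff
      Rep_closed_long_ray_inject[symmetric])

end

instantiation closed_long_ray :: order_bot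
begin

definition bot_closed_long_ray :: closed_long_ray where
  "bot = Abs_closed_long_ray (bot, 0)"

instance
proof
  fix x :: closed_long_ray
  have "0 \<le> snd (Rep_closed_long_ray x)"
    using Rep_closed_long_ray[of x] by (auto simp: mem_Times_iff)
  then show "bot \<le> x"
    by (auto simp: bot_closed_long_ray_def less_eq_closed_long_ray_def
        Abs_closed_long_ray_inverse less_le)
qed

end

instantiation closed_long_ray :: linorder_topology
begin

definition open_closed_long_ray :: "closed_long_ray set \<Rightarrow> bool" where
  "open_closed_long_ray = generate_topology (range (\<lambda>a. {..< a}) \<union> range (\<lambda>a. {a <..}))"

instance
  by standard (rule open_closed_long_ray_def)

end

lemma Abs_closed_long_ray_eq_bot_iff:
  assumes "0 \<le> t" "t < 1"
  shows "Abs_closed_long_ray (\<alpha>, t) = bot \<longleftrightarrow> \<alpha> = bot \<and> t = 0"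
  using assms by (simp add: bot_closed_long_ray_def Abs_closed_long_ray_inject)

typedef long_ray = "{x :: closed_long_ray. x \<noteq> bot}"
  by (rule exI[of _ "Abs_closed_long_ray (bot, 1/2)"]) (simp add: Abs_closed_long_ray_eq_bot_iff)

instantiation long_ray :: linorder
begin

definition less_eq_long_ray :: "long_ray \<Rightarrow> long_ray \<Rightarrow> bool" where
  "x \<le> y \<longleftrightarrow> Rep_long_ray x \<le> Rep_long_ray y"

definition less_long_ray :: "long_ray \<Rightarrow> long_ray \<Rightarrow> bool" where
  "x < y \<longleftrightarrow> Rep_long_ray x < Rep_long_ray y"

instance
  by standard (auto simp: less_eq_long_ray_def less_long_ray_def less_le Rep_long_ray_inject)

end

text \<open>The topology is the subspace topology inherited from the closed long ray; the instance
  proof shows that it coincides with the order topology.\<close>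

instantiation long_ray :: linorder_topology
begin

definition open_long_ray :: "long_ray set \<Rightarrow> bool" where
  "open_long_ray U \<longleftrightarrow> (\<exists>V. open V \<and> U = Rep_long_ray -` V)"

instance
proof
  let ?G = "generate_topology (range (\<lambda>a :: long_ray. {..< a}) \<union> range (\<lambda>a. {a <..}))"
  have 1: "?G (Rep_long_ray -` V)" if "open V" for V
    using that unfolding open_generated_order[where 'a = closed_long_ray]
  proof (induction rule: generate_topology.induct)
    case UNIV
    then show ?case by (simp add: generate_topology.UNIV)
  next
    case (Int a b)
    then show ?case by (simp add: generate_topology.Int)
  next
    case (UN K)
    have "?G (\<Union> ((\<lambda>V. Rep_long_ray -` V) ` K))"
      by (rule generate_topology.UN) (use UN in auto)
    then show ?case by (simp add: vimage_Union)
  next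
    case (Basis s)
    then obtain a where s: "s = {..<a} \<or> s = {a<..}" by auto
    show ?case
    proof (cases "a = bot")
      case True
      then have "Rep_long_ray -` s = \<Union>{} \<or> Rep_long_ray -` s = UNIV"
        using s Rep_long_ray by (auto simp: bot.not_eq_extremum[symmetric])
      then show ?thesis
        using generate_topology.UNIV generate_topology.UN[of "{}"] by auto
    next
      case False
      then have "Rep_long_ray -` s = {..<Abs_long_ray a} \<or> Rep_long_ray -` s = {Abs_long_ray a<..}"
        using s by (auto simp: less_long_ray_def Abs_long_ray_inverse)
      then show ?thesis by (auto intro!: generate_topology.Basis)
    qed
  qed
  have 2: "open U" if "?G U" for U
    using that
  proof (induction rule: generate_topology.induct)
    case UNIV
    have "open (UNIV :: closed_long_ray set) \<and> UNIV = Rep_long_ray -` UNIV" by simp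
    then show ?case unfolding open_long_ray_def by blast
  next
    case (Int a b)
    then obtain V W where "open V" "a = Rep_long_ray -` V" "open W" "b = Rep_long_ray -` W"
      unfolding open_long_ray_def by blast
    then have "open (V \<inter> W) \<and> a \<inter> b = Rep_long_ray -` (V \<inter> W)" by auto
    then show ?case unfolding open_long_ray_def by blast
  next
    case (UN K)
    then have "\<forall>k\<in>K. \<exists>V. open V \<and> k = Rep_long_ray -` V"
      unfolding open_long_ray_def by blast
    then obtain V where "\<forall>k\<in>K. open (V k) \<and> k = Rep_long_ray -` V k" by metis
    then have "open (\<Union>(V ` K)) \<and> \<Union>K = Rep_long_ray -` \<Union>(V ` K)" by fastforce
    then show ?case unfolding open_long_ray_def by blast
  next
    case (Basis s)
    then obtain a where "s = {..<a} \<or> s = {a<..}" by auto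
    then have "(open {..<Rep_long_ray a} \<and> s = Rep_long_ray -` {..<Rep_long_ray a}) \<or>
        (open {Rep_long_ray a<..} \<and> s = Rep_long_ray -` {Rep_long_ray a<..})"
      by (auto simp: less_long_ray_def)
    then show ?case unfolding open_long_ray_def by (elim disjE) (rule exI, assumption)+
  qed
  show "open = ?G"
  proof (intro ext iffI)
    fix U :: "long_ray set"
    assume "open U"
    then obtain V where "open V" "U = Rep_long_ray -` V"
      unfolding open_long_ray_def by blast
    then show "?G U" using 1 by simp
  qed (rule 2)
qed

end

text \<open>The point \<open>\<alpha> + 0\<close> of the long ray; only meaningful for \<open>\<alpha> \<noteq> bot\<close>, since the point
  \<open>(0, 0)\<close> has been removed.\<close>

definition ray_of_omega1 :: "omega1 \<Rightarrow> long_ray" where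
  "ray_of_omega1 \<alpha> = Abs_long_ray (Abs_closed_long_ray (\<alpha>, 0))"

text \<open>Clubs of \<open>\<omega>\<^sub>1\<close> are only ever used as subsets of the long ray, hence \<open>0\<close> is excluded.\<close>

definition club_omega1 :: "omega1 set \<Rightarrow> bool" where
  "club_omega1 C \<longleftrightarrow> closed C \<and> \<not> bdd_above C \<and> bot \<notin> C"


section \<open>The circle as the reals modulo \<open>2\<pi>\<close>\<close>

quotient_type circle = real / "\<lambda>x y. [x = y] (rmod (2 * pi))"
  by (rule equivpI) (auto intro: reflpI sympI transpI rcong_sym rcong_trans)

instantiation circle :: ab_group_add
begin

lift_definition zero_circle :: circle is 0 .
lift_definition plus_circle :: "circle \<Rightarrow> circle \<Rightarrow> circle" is "(+)" by (rule rcong_add)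
lift_definition minus_circle :: "circle \<Rightarrow> circle \<Rightarrow> circle" is "(-)" by (rule rcong_diff)
lift_definition uminus_circle :: "circle \<Rightarrow> circle" is uminus by (rule rcong_uminus)

instance
  by standard (transfer; simp add: algebra_simps)+

end

text \<open>The quotient topology.\<close>

instantiation circle :: topological_space
begin

definition open_circle :: "circle set \<Rightarrow> bool" where
  "open_circle U \<longleftrightarrow> open (abs_circle -` U)"

instance
  by standard (auto simp: open_circle_def vimage_Union)

end


section \<open>Principal circle bundles over the long ray\<close>

text \<open>The total space \<open>M\<close> is the whole type \<open>'m\<close>, and \<open>act x \<theta>\<close> is \<open>x + \<theta>\<close>. Local
  trivialisations are not required to be equivariant.\<close>

definition principal_circle_bundle ::
    "('m::topological_space \<Rightarrow> long_ray) \<Rightarrow> ('m \<Rightarrow> circle \<Rightarrow> 'm) \<Rightarrow> bool" where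
  "principal_circle_bundle \<pi> act \<longleftrightarrow>
     continuous_on UNIV \<pi> \<and>
     (\<forall>p. \<exists>U h g. open U \<and> p \<in> U \<and>
        homeomorphism (\<pi> -` U) (U \<times> (UNIV :: circle set)) h g \<and>
        (\<forall>x\<in>\<pi> -` U. fst (h x) = \<pi> x)) \<and>
     continuous_on UNIV (\<lambda>(x, \<theta>). act x \<theta>) \<and>
     (\<forall>x. act x 0 = x) \<and>
     (\<forall>x \<theta> \<phi>. act (act x \<theta>) \<phi> = act x (\<theta> + \<phi>)) \<and>
     (\<forall>x \<theta>. \<pi> (act x \<theta>) = \<pi> x) \<and>
     (\<forall>x \<theta>. act x \<theta> = x \<longrightarrow> \<theta> = 0) \<and>
     (\<forall>x y. \<pi> x = \<pi> y \<longrightarrow> (\<exists>\<theta>. act x \<theta> = y))"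

definition club_bundle :: "('m::topological_space \<Rightarrow> long_ray) \<Rightarrow> 'm set \<Rightarrow> bool" where
  "club_bundle \<pi> E \<longleftrightarrow> closed E \<and> \<not> bdd_above (\<pi> ` E)"

definition order_infinite :: "('m::topological_space \<Rightarrow> long_ray) \<Rightarrow> bool" where
  "order_infinite \<pi> \<longleftrightarrow>
     (\<forall>F. club_bundle \<pi> F \<longrightarrow> (\<exists>C. club_omega1 C \<and> \<pi> -` ray_of_omega1 ` C \<subseteq> F))"

definition has_periodic_club ::
    "('m::topological_space \<Rightarrow> long_ray) \<Rightarrow> ('m \<Rightarrow> circle \<Rightarrow> 'm) \<Rightarrow> nat \<Rightarrow> bool" where
  "has_periodic_club \<pi> act n \<longleftrightarrow>
     (\<exists>E C. club_bundle \<pi> E \<and> club_omega1 C \<and>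
        (\<forall>\<alpha>\<in>C. let E\<^sub>\<alpha> = E \<inter> \<pi> -` {ray_of_omega1 \<alpha>} in
           card E\<^sub>\<alpha> = n \<and>
           (\<forall>x\<in>E\<^sub>\<alpha>. E\<^sub>\<alpha> = {act x (abs_circle (2 * pi * real k / real n)) | k. k < n})))"

text \<open>\<open>has_order \<pi> act n\<close> reads ``\<open>M\<close> is of order \<open>n\<close>''. It is a relation so that no value
  is assigned by default should no suitable finite \<open>n\<close> exist.\<close>

fun has_order ::
    "('m::topological_space \<Rightarrow> long_ray) \<Rightarrow> ('m \<Rightarrow> circle \<Rightarrow> 'm) \<Rightarrow> enat \<Rightarrow> bool" where
  "has_order \<pi> act \<infinity> \<longleftrightarrow> order_infinite \<pi>"
| "has_order \<pi> act (enat n) \<longleftrightarrow>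
     \<not> order_infinite \<pi> \<and>
     1 \<le> n \<and> has_periodic_club \<pi> act n \<and>
     (\<forall>m. 1 \<le> m \<and> has_periodic_club \<pi> act m \<longrightarrow> n \<le> m)"

end

theory Submission
  imports Defs
begin

text \<open>Write \<open>\<omega>\<^sub>1\<close> for the first uncountable ordinal and \<open>L\<close> for the long ray.

  Suppose \<open>k\<close> embeds \<open>\<omega>\<^sub>1\<close> in \<open>M\<close>. The map \<open>f = \<pi> \<circ> k\<close> into \<open>L\<close> is unbounded
  (\<open>omega1_unbounded_in_bundle\<close>): bounded parts of \<open>L\<close> have a countable order-dense subset, and
  a continuous map from \<open>\<omega>\<^sub>1\<close> into such an order is eventually constant
  (\<open>eventually_constant_omega1\<close>), so a bounded \<open>f\<close> would force a tail of \<open>k\<close> into a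
  single circle, where \<open>k\<close> would be eventually constant as well, against injectivity. Since \<open>f\<close>
  is continuous and unbounded, interleaving \<open>f\<close> with the inclusion of \<open>\<omega>\<^sub>1\<close> in \<open>L\<close> shows
  that \<open>C = {\<alpha>. f \<alpha> = \<alpha>}\<close> is a club (\<open>club_omega1_fixed_points\<close>). The copy of \<open>\<omega>\<^sub>1\<close>
  itself may meet a fibre in many points, because \<open>f\<close> need not be monotone; but \<open>k ` C\<close> meets
  the fibre over each \<open>\<alpha> \<in> C\<close> exactly in \<open>k \<alpha>\<close>, and it is closed since its bounded parts are
  compact. It is thus a club witnessing order \<open>1\<close>, and it also shows that the order is not
  infinite, as it contains no complete fibre.

  Conversely, let a club \<open>E\<close> of \<open>M\<close> meet the fibre over each \<open>\<alpha>\<close> in a club \<open>C\<close> in one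
  point \<open>s \<alpha>\<close>. The fibres are compact, so \<open>\<pi>\<close> is a closed map
  (\<open>principal_circle_bundle_tube\<close>), which makes \<open>s\<close> continuous. The increasing enumeration of
  \<open>C\<close> is a continuous map from \<open>\<omega>\<^sub>1\<close> into \<open>C\<close>, and its composition with \<open>s\<close> is an
  embedding because \<open>\<pi>\<close> takes it to a strictly increasing map
  (\<open>range_homeomorphic_omega1\<close>).\<close>

section \<open>Topology of the first uncountable ordinal\<close>

lemma countable_atMost_omega1: "countable {..\<alpha> :: omega1}"
  using countable_lessThan_omega1[of \<alpha>] by (simp add: ivl_disj_un_singleton(2)[symmetric])

text \<open>This is the regularity of \<open>\<omega>\<^sub>1\<close>: a countable union of countable initial segments does not
  exhaust it.\<close>

lemma countable_bounded_omega1: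
  assumes "countable (A :: omega1 set)"
  shows "\<exists>\<beta>. \<forall>\<alpha>\<in>A. \<alpha> < \<beta>"
proof -
  have "countable (\<Union>\<alpha>\<in>A. {..\<alpha>})"
    using assms countable_atMost_omega1 by blast
  then have "(\<Union>\<alpha>\<in>A. {..\<alpha>}) \<noteq> UNIV"
    using uncountable_omega1 by metis
  then obtain \<beta> where "\<beta> \<notin> (\<Union>\<alpha>\<in>A. {..\<alpha>})" by blast
  then show ?thesis
    by (intro exI[of _ \<beta>]) (auto simp: not_le)
qed

instance omega1 :: no_top
proof
  fix \<alpha> :: omega1
  show "\<exists>\<beta>. \<alpha> < \<beta>"
    using countable_bounded_omega1[of "{\<alpha>}"] by simp
qed

text \<open>A closed initial segment is also the open one below the successor. Hence neighbourhoods of a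
  point only matter on its left.\<close>

lemma open_atMost_omega1: "open {..\<alpha> :: omega1}"
proof -
  have "{..\<alpha>} = {..<(LEAST \<beta>. \<alpha> < \<beta>)}"
    using LeastI_ex[OF gt_ex[of \<alpha>]] not_less_Least[of _ "\<lambda>\<beta>. \<alpha> < \<beta>"]
    by (auto intro: le_less_trans) (use not_le in blast)
  then show ?thesis by simp
qed

lemma closed_nonzero_omega1: "closed ({bot <..} :: omega1 set)"
proof -
  have "{bot <..} = - {..bot :: omega1}" by auto
  then show ?thesis by (simp add: closed_def open_atMost_omega1)
qed

text \<open>Some member of an open cover contains a left neighbourhood \<open>{\<beta><..\<alpha>}\<close> of the top point, and
  what remains is a shorter segment, covered finitely by induction.\<close>

lemma compact_atMost_omega1: "compact {..\<alpha> :: omega1}"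
proof (induction \<alpha> rule: less_induct)
  case (less \<alpha>)
  show ?case
  proof (rule compactI)
    fix \<C> :: "omega1 set set"
    assume op: "\<forall>U\<in>\<C>. open U" and cov: "{..\<alpha>} \<subseteq> \<Union>\<C>"
    then obtain U where U: "U \<in> \<C>" "\<alpha> \<in> U" by auto
    show "\<exists>\<C>'\<subseteq>\<C>. finite \<C>' \<and> {..\<alpha>} \<subseteq> \<Union>\<C>'"
    proof (cases "\<alpha> = bot")
      case True
      then have "{..\<alpha>} \<subseteq> \<Union>{U}" using U by (auto simp: bot.extremum_unique)
      then show ?thesis using U by (intro exI[of _ "{U}"]) auto
    next
      case False
      then obtain \<beta> where \<beta>: "\<beta> < \<alpha>" "{\<beta><..\<alpha>} \<subseteq> U"
        using open_left[of U \<alpha> bot] op U by (auto simp: bot.not_eq_extremum)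
      then have "{..\<beta>} \<subseteq> \<Union>\<C>" using cov by auto
      then obtain \<D> where \<D>: "\<D> \<subseteq> \<C>" "finite \<D>" "{..\<beta>} \<subseteq> \<Union>\<D>"
        by (rule compactE[OF less.IH[OF \<beta>(1)]]) (use op in blast)+
      have "{..\<alpha>} \<subseteq> {..\<beta>} \<union> {\<beta><..\<alpha>}" by auto
      then have "{..\<alpha>} \<subseteq> \<Union>(insert U \<D>)" using \<beta> \<D> by auto
      then show ?thesis using U \<D> by (intro exI[of _ "insert U \<D>"]) auto
    qed
  qed
qed

text \<open>Every point of \<open>\<omega>\<^sub>1\<close> other than a limit ordinal is isolated, and neighbourhoods of a limit
  ordinal can be taken to its left. So a monotone map is continuous as soon as its values at limit
  ordinals are approached from below.\<close>

lemma continuous_on_omega1I: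
  fixes g :: "omega1 \<Rightarrow> 'a::order_topology"
  assumes S: "open S" and mono: "mono_on S g"
    and left: "\<And>\<alpha> p. \<alpha> \<in> S \<Longrightarrow> bot < \<alpha> \<Longrightarrow> (\<And>\<beta>. \<beta> < \<alpha> \<Longrightarrow> \<exists>\<gamma>>\<beta>. \<gamma> < \<alpha>) \<Longrightarrow> p < g \<alpha> \<Longrightarrow>
      \<exists>\<beta>\<in>S. \<beta> < \<alpha> \<and> p < g \<beta>"
  shows "continuous_on S g"
proof -
  have "(g \<longlongrightarrow> g \<alpha>) (nhds \<alpha>)" if \<alpha>: "\<alpha> \<in> S" for \<alpha>
  proof (rule order_tendstoI)
    fix p assume p: "p < g \<alpha>"
    consider "\<alpha> = bot" | \<beta> where "\<beta> < \<alpha>" "\<not> (\<exists>\<gamma>>\<beta>. \<gamma> < \<alpha>)"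
      | \<beta> where "\<beta> \<in> S" "\<beta> < \<alpha>" "p < g \<beta>"
      using left[OF \<alpha> _ _ p] bot.not_eq_extremum by metis
    then have "\<exists>U. open U \<and> \<alpha> \<in> U \<and> (\<forall>x\<in>U. p < g x)"
    proof cases
      case 1
      then show ?thesis using p open_atMost_omega1[of \<alpha>]
        by (intro exI[of _ "{..\<alpha>}"]) (auto simp: bot.extremum_unique)
    next
      case (2 \<beta>)
      then have "{\<beta><..} \<inter> {..\<alpha>} = {\<alpha>}" by fastforce
      moreover have "open ({\<beta><..} \<inter> {..\<alpha>})" by (intro open_Int open_atMost_omega1) simp
      ultimately show ?thesis using p by (intro exI[of _ "{\<alpha>}"]) simp
    next
      case (3 \<beta>)
      then have "p < g x" if "x \<in> {\<beta><..} \<inter> S" for x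
        using that mono_onD[OF mono 3(1), of x] 3(3) by (simp add: less_imp_le less_le_trans)
      then show ?thesis using 3 \<alpha> S
        by (intro exI[of _ "{\<beta><..} \<inter> S"]) auto
    qed
    then show "\<forall>\<^sub>F x in nhds \<alpha>. p < g x" unfolding eventually_nhds .
  next
    fix p assume p: "g \<alpha> < p"
    have "g x < p" if "x \<in> {..\<alpha>} \<inter> S" for x
      using that mono_onD[OF mono _ \<alpha>, of x] p by (simp add: le_less_trans)
    then show "\<forall>\<^sub>F x in nhds \<alpha>. g x < p"
      unfolding eventually_nhds using \<alpha> S open_atMost_omega1[of \<alpha>]
      by (intro exI[of _ "{..\<alpha>} \<inter> S"]) auto
  qed
  then show ?thesis
    unfolding continuous_on_def by (meson at_le subset_UNIV tendsto_mono at_within_le_nhds)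
qed

text \<open>Interleaving arguments in \<open>\<omega>\<^sub>1\<close> all use this: a requirement \<open>R\<close> that can be met above
  every ordinal can be met \<open>\<omega>\<close> times in a row, and the steps converge to their supremum.\<close>

lemma omega_chain:
  fixes R :: "omega1 \<Rightarrow> omega1 \<Rightarrow> bool"
  assumes "\<And>\<beta>. \<exists>\<gamma>>\<beta>. R \<beta> \<gamma>"
  obtains a \<alpha> where "a \<longlonglongrightarrow> \<alpha>" "\<And>n. R (a n) (a (Suc n))" "\<delta> < \<alpha>"
proof -
  obtain a where a: "a 0 = \<delta>" "\<And>n. a n < a (Suc n)" "\<And>n. R (a n) (a (Suc n))"
    using dependent_nat_choice[of "\<lambda>n x. n = 0 \<longrightarrow> x = \<delta>" "\<lambda>n x y. x < y \<and> R x y"] assms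
    by (metis nat.distinct(1))
  have mono: "strict_mono a" by (rule strict_mono_Suc_iff[THEN iffD2]) (use a in auto)
  obtain b where "\<And>n. a n < b"
    using countable_bounded_omega1[of "range a"] by auto
  then have ex: "\<exists>b. \<forall>n. a n \<le> b" by (meson less_imp_le)
  define \<alpha> where "\<alpha> = (LEAST b. \<forall>n. a n \<le> b)"
  have le: "a n \<le> \<alpha>" for n
    using LeastI_ex[OF ex] by (simp add: \<alpha>_def)
  then have less: "a n < \<alpha>" for n
    using a(2) less_le_trans by blast
  have "a \<longlonglongrightarrow> \<alpha>"
  proof (rule order_tendstoI)
    fix p assume "p < \<alpha>"
    then obtain n where "p < a n"
      using not_less_Least[of p "\<lambda>b. \<forall>n. a n \<le> b"] by (auto simp: \<alpha>_def not_le)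
    then show "\<forall>\<^sub>F n in sequentially. p < a n"
      using strict_mono_mono[OF mono, THEN monoD] eventually_sequentially less_le_trans by metis
  next
    fix p assume "\<alpha> < p"
    then show "\<forall>\<^sub>F n in sequentially. a n < p"
      using less by (intro always_eventually) (blast intro: less_trans)
  qed
  then show thesis using that a(1,3) less[of 0] by simp
qed

lemma interleaved_limit:
  fixes a :: "nat \<Rightarrow> 'a::linorder_topology"
  assumes "a \<longlonglongrightarrow> \<alpha>" "\<And>n. a n \<le> x n" "\<And>n. x n \<le> a (Suc n)"
  shows "x \<longlonglongrightarrow> \<alpha>"
  using assms by (intro tendsto_sandwich[OF _ _ assms(1) LIMSEQ_Suc[OF assms(1)]]) auto

text \<open>Elements of \<open>A\<close> and of \<open>B\<close>, chosen alternately and increasing, have a common limit.\<close>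

lemma closed_unbounded_omega1_meet:
  fixes A B :: "omega1 set"
  assumes A: "closed A" "\<And>\<beta>. \<exists>\<alpha>\<in>A. \<beta> < \<alpha>" and B: "closed B" "\<And>\<beta>. \<exists>\<alpha>\<in>B. \<beta> < \<alpha>"
  shows "A \<inter> B \<noteq> {}"
proof -
  have "\<exists>\<gamma>>\<beta>. \<exists>x\<in>A. \<exists>y\<in>B. \<beta> \<le> x \<and> x \<le> \<gamma> \<and> \<beta> \<le> y \<and> y \<le> \<gamma>" for \<beta>
  proof -
    obtain x y where xy: "x \<in> A" "\<beta> < x" "y \<in> B" "x < y" using A(2) B(2) by meson
    then have "\<beta> \<le> x \<and> x \<le> y \<and> \<beta> \<le> y \<and> y \<le> y" "\<beta> < y" by auto
    then show ?thesis using xy(1,3) by blast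
  qed
  then obtain a \<alpha> where a: "a \<longlonglongrightarrow> \<alpha>" and
    R: "\<And>n. \<exists>x\<in>A. \<exists>y\<in>B. a n \<le> x \<and> x \<le> a (Suc n) \<and> a n \<le> y \<and> y \<le> a (Suc n)"
    and "bot < \<alpha>"
    by (rule omega_chain[where \<delta> = bot]) (rule that)
  from R obtain x y where "\<And>n. x n \<in> A \<and> y n \<in> B \<and> a n \<le> x n \<and> x n \<le> a (Suc n) \<and>
      a n \<le> y n \<and> y n \<le> a (Suc n)"
    by metis
  then have xy: "\<And>n. x n \<in> A" "\<And>n. y n \<in> B" and "x \<longlonglongrightarrow> \<alpha>" "y \<longlonglongrightarrow> \<alpha>"
    using interleaved_limit[OF a, of x] interleaved_limit[OF a, of y] by auto
  then have "\<alpha> \<in> A" "\<alpha> \<in> B"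
    using closed_sequentially[OF A(1), of x] closed_sequentially[OF B(1), of y] by blast+
  then show ?thesis by blast
qed

text \<open>For \<open>d < d'\<close> in \<open>D\<close>, the closed sets \<open>{\<alpha>. f \<alpha> \<le> d}\<close> and \<open>{\<alpha>. d' \<le> f \<alpha>}\<close> are
  disjoint, so one of them is bounded. Beyond all these countably many bounds, no two values of \<open>f\<close>
  are separated by a pair from \<open>D\<close>, so they are all equal.\<close>

lemma eventually_constant_omega1:
  fixes f :: "omega1 \<Rightarrow> 'a::linorder_topology"
  assumes f: "continuous_on UNIV f" and D: "countable D"
    and sep: "\<And>\<alpha> \<beta>. f \<alpha> < f \<beta> \<Longrightarrow> \<exists>d\<in>D. \<exists>d'\<in>D. f \<alpha> \<le> d \<and> d < d' \<and> d' \<le> f \<beta>"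
  obtains \<gamma> c where "\<And>\<alpha>. \<gamma> < \<alpha> \<Longrightarrow> f \<alpha> = c"
proof -
  have "\<exists>\<gamma>. (\<forall>\<alpha>>\<gamma>. d < f \<alpha>) \<or> (\<forall>\<alpha>>\<gamma>. f \<alpha> < d')" if "d < d'" for d d'
  proof (rule ccontr)
    assume neg: "\<not> ?thesis"
    have "f -` {..d} \<inter> f -` {d'..} \<noteq> {}"
      by (rule closed_unbounded_omega1_meet)
        (use neg f in \<open>auto intro!: closed_vimage simp: not_less Bex_def\<close>)
    then show False using that by auto
  qed
  then obtain G where G: "\<And>d d'. d < d' \<Longrightarrow>
      (\<forall>\<alpha>>G d d'. d < f \<alpha>) \<or> (\<forall>\<alpha>>G d d'. f \<alpha> < d')"
    by metis
  have "countable (case_prod G ` (D \<times> D))" using D by blast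
  then obtain \<gamma> where \<gamma>: "\<And>d d'. d \<in> D \<Longrightarrow> d' \<in> D \<Longrightarrow> G d d' < \<gamma>"
    using countable_bounded_omega1[of "case_prod G ` (D \<times> D)"] by auto
  have no: "\<not> f \<alpha> < f \<beta>" if "\<gamma> < \<alpha>" "\<gamma> < \<beta>" for \<alpha> \<beta>
  proof
    assume "f \<alpha> < f \<beta>"
    then obtain d d' where d: "d \<in> D" "d' \<in> D" "f \<alpha> \<le> d" "d < d'" "d' \<le> f \<beta>" using sep by blast
    then have "G d d' < \<gamma>" using \<gamma> by blast
    then have "d < f \<alpha> \<or> f \<beta> < d'" using G[OF d(4)] that by (meson less_trans)
    then show False using d by auto
  qed
  obtain \<alpha>0 where "\<gamma> < \<alpha>0" using gt_ex by blast
  then show thesis using that[of \<gamma> "f \<alpha>0"] no by (meson linorder_less_linear)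
qed

function club_enum :: "omega1 set \<Rightarrow> omega1 \<Rightarrow> omega1" where
  "club_enum C \<alpha> = (LEAST \<gamma>. \<gamma> \<in> C \<and> (\<forall>\<beta>\<in>{..<\<alpha>}. club_enum C \<beta> < \<gamma>))"
  by auto
termination
  by (relation "inv_image {(x, y). x < y} snd") (auto simp: wf_omega1)

declare club_enum.simps [simp del]

text \<open>The enumeration is continuous because, at a limit \<open>\<alpha>\<close>, the supremum of the earlier values lies
  in the closed set \<open>C\<close> and is therefore the next value.\<close>

lemma club_enum:
  assumes "closed C" "\<not> bdd_above C"
  shows "club_enum C \<alpha> \<in> C" "strict_mono (club_enum C)" "continuous_on UNIV (club_enum C)"
proof -
  let ?e = "club_enum C"
  have "\<exists>\<gamma>. \<gamma> \<in> C \<and> (\<forall>\<beta>\<in>{..<\<alpha>}. ?e \<beta> < \<gamma>)" for \<alpha>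
  proof -
    obtain \<delta> where \<delta>: "\<And>\<beta>. \<beta> < \<alpha> \<Longrightarrow> ?e \<beta> < \<delta>"
      using countable_bounded_omega1[of "?e ` {..<\<alpha>}"] countable_lessThan_omega1 by auto
    obtain \<gamma> where "\<gamma> \<in> C" "\<delta> < \<gamma>"
      using assms(2) by (meson bdd_aboveI not_le)
    then show ?thesis using \<delta> by (metis lessThan_iff less_trans)
  qed
  from LeastI_ex[OF this] have e: "?e \<alpha> \<in> C \<and> (\<forall>\<beta>\<in>{..<\<alpha>}. ?e \<beta> < ?e \<alpha>)" for \<alpha>
    by (simp flip: club_enum.simps)
  then show "?e \<alpha> \<in> C" by blast
  show mono: "strict_mono ?e" using e by (auto simp: strict_mono_def)
  have least: "?e \<alpha> \<le> \<gamma>" if "\<gamma> \<in> C" "\<And>\<beta>. \<beta> < \<alpha> \<Longrightarrow> ?e \<beta> < \<gamma>" for \<alpha> \<gamma>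
    unfolding club_enum.simps[of C \<alpha>] by (rule Least_le) (use that in auto)
  show "continuous_on UNIV ?e"
  proof (rule continuous_on_omega1I)
    fix \<alpha> p
    assume bot: "bot < \<alpha>" and lim: "\<And>\<beta>. \<beta> < \<alpha> \<Longrightarrow> \<exists>\<gamma>>\<beta>. \<gamma> < \<alpha>" and p: "p < ?e \<alpha>"
    show "\<exists>\<beta>\<in>UNIV. \<beta> < \<alpha> \<and> p < ?e \<beta>"
    proof (rule ccontr)
      assume "\<not> ?thesis"
      then have ub: "\<forall>\<beta><\<alpha>. ?e \<beta> \<le> p" by (metis UNIV_I not_less)
      define \<sigma> where "\<sigma> = (LEAST \<sigma>. \<forall>\<beta><\<alpha>. ?e \<beta> \<le> \<sigma>)"
      have "\<sigma> \<le> p" unfolding \<sigma>_def by (rule Least_le) (rule ub)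
      have \<sigma>: "\<forall>\<beta><\<alpha>. ?e \<beta> \<le> \<sigma>" unfolding \<sigma>_def by (rule LeastI) (rule ub)
      then have less: "?e \<beta> < \<sigma>" if "\<beta> < \<alpha>" for \<beta>
        using lim[OF that] mono by (meson less_le_trans strict_monoD)
      have "\<sigma> \<in> C"
      proof (rule ccontr)
        assume "\<sigma> \<notin> C"
        then obtain b where b: "b < \<sigma>" "{b<..\<sigma>} \<subseteq> - C"
          using open_left[of "- C" \<sigma> "?e bot"] less[OF bot] assms(1) by (auto simp: closed_def)
        then obtain \<beta> where "\<beta> < \<alpha>" "b < ?e \<beta>"
          using not_less_Least[of b "\<lambda>\<sigma>. \<forall>\<beta><\<alpha>. ?e \<beta> \<le> \<sigma>"] by (auto simp: \<sigma>_def not_le)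
        then show False using b less e by fastforce
      qed
      then have "?e \<alpha> \<le> \<sigma>" using least less by blast
      then show False using p \<open>\<sigma> \<le> p\<close> by simp
    qed
  qed (use mono in \<open>auto simp: strict_mono_mono\<close>)
qed

text \<open>The inverse of a strictly monotone map is continuous for the order topology, since the initial and
  final segments of \<open>\<omega>\<^sub>1\<close> are cut out by those of the codomain of \<open>q\<close>.\<close>

lemma range_homeomorphic_omega1:
  fixes s :: "omega1 \<Rightarrow> 'm::topological_space" and q :: "'m \<Rightarrow> 'a::linorder_topology"
  assumes s: "continuous_on UNIV s" and q: "continuous_on UNIV q"
    and mono: "strict_mono (q \<circ> s)"
  shows "range s homeomorphic (UNIV :: omega1 set)"
proof -
  have lt: "q (s \<alpha>) < q (s \<beta>) \<longleftrightarrow> \<alpha> < \<beta>" for \<alpha> \<beta>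
    using strict_mono_less[OF mono] by simp
  have inj: "inj s" by (rule injI) (metis lt less_irrefl linorder_neqE)
  have "continuous_on (range s) (inv s)"
  proof (rule continuous_on_generate_topology[OF open_omega1_def])
    fix B :: "omega1 set"
    assume "B \<in> range (\<lambda>a. {..<a}) \<union> range (\<lambda>a. {a<..})"
    then obtain a where "B = {..<a} \<or> B = {a<..}" by auto
    then have "q -` {..<q (s a)} \<inter> range s = inv s -` B \<inter> range s \<or>
        q -` {q (s a)<..} \<inter> range s = inv s -` B \<inter> range s"
      by (auto simp: lt inj)
    moreover have "open (q -` {..<q (s a)})" "open (q -` {q (s a)<..})"
      using q by (auto intro: open_vimage)
    ultimately show "\<exists>V. open V \<and> V \<inter> range s = inv s -` B \<inter> range s" by blast
  qed
  then have "homeomorphism (UNIV :: omega1 set) (range s) s (inv s)"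
    using s inj by (auto simp: homeomorphism_def)
  then show ?thesis using homeomorphic_sym homeomorphic_def by blast
qed

section \<open>The long ray\<close>

definition ray_coords :: "long_ray \<Rightarrow> omega1 \<times> real" where
  "ray_coords x = Rep_closed_long_ray (Rep_long_ray x)"

lemma less_long_ray_iff: "x < y \<longleftrightarrow> fst (ray_coords x) < fst (ray_coords y) \<or>
    fst (ray_coords x) = fst (ray_coords y) \<and> snd (ray_coords x) < snd (ray_coords y)"
  by (auto simp: ray_coords_def less_long_ray_def less_closed_long_ray_def
      less_eq_closed_long_ray_def)

lemma snd_ray_coords: "0 \<le> snd (ray_coords x)" "snd (ray_coords x) < 1"
  using Rep_closed_long_ray[of "Rep_long_ray x"] by (auto simp: ray_coords_def)

lemma ray_coords_Abs:
  assumes "0 \<le> t" "t < 1" "\<alpha> \<noteq> bot \<or> t \<noteq> 0"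
  shows "ray_coords (Abs_long_ray (Abs_closed_long_ray (\<alpha>, t))) = (\<alpha>, t)"
  using assms by (simp add: ray_coords_def Abs_long_ray_inverse Abs_closed_long_ray_eq_bot_iff
      Abs_closed_long_ray_inverse)

lemma ray_coords_ray_of_omega1: "bot < \<alpha> \<Longrightarrow> ray_coords (ray_of_omega1 \<alpha>) = (\<alpha>, 0)"
  by (simp add: ray_of_omega1_def ray_coords_Abs bot.not_eq_extremum)

lemma ray_of_omega1_less_iff:
  "bot < \<alpha> \<Longrightarrow> bot < \<beta> \<Longrightarrow> ray_of_omega1 \<alpha> < ray_of_omega1 \<beta> \<longleftrightarrow> \<alpha> < \<beta>"
  by (simp add: less_long_ray_iff ray_coords_ray_of_omega1)

lemma ray_of_omega1_eq_iff:
  "bot < \<alpha> \<Longrightarrow> bot < \<beta> \<Longrightarrow> ray_of_omega1 \<alpha> = ray_of_omega1 \<beta> \<longleftrightarrow> \<alpha> = \<beta>"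
  by (metis ray_coords_ray_of_omega1 fst_conv)

text \<open>The hypothesis excludes \<open>\<alpha> = bot\<close>, where \<open>ray_of_omega1\<close> has an arbitrary value.\<close>

lemma less_ray_of_omega1:
  "fst (ray_coords x) < \<alpha> \<Longrightarrow> x < ray_of_omega1 \<alpha>"
  using ray_coords_ray_of_omega1[of \<alpha>] by (simp add: less_long_ray_iff order_le_less_trans[OF bot_least])

lemma ray_of_omega1_cofinal: obtains \<beta> where "\<alpha> < \<beta>" "x < ray_of_omega1 \<beta>"
proof -
  obtain \<beta> where "max \<alpha> (fst (ray_coords x)) < \<beta>" using gt_ex by blast
  then show thesis using that[of \<beta>] less_ray_of_omega1[of x \<beta>] by simp
qed

lemma countable_bounded_long_ray:
  assumes "countable (A :: long_ray set)"
  obtains p where "\<And>x. x \<in> A \<Longrightarrow> x < p"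
proof -
  obtain \<beta> where \<beta>: "\<And>x. x \<in> A \<Longrightarrow> fst (ray_coords x) < \<beta>"
    using countable_bounded_omega1[of "(fst \<circ> ray_coords) ` A"] assms by auto
  show thesis by (rule that[of "ray_of_omega1 \<beta>"]) (use \<beta> less_ray_of_omega1 in blast)
qed

lemma continuous_on_ray_of_omega1: "continuous_on {bot <..} ray_of_omega1"
proof (rule continuous_on_omega1I)
  show "mono_on {bot<..} ray_of_omega1"
    by (rule mono_onI) (metis greaterThan_iff le_less ray_of_omega1_less_iff)
  fix \<alpha> p
  assume \<alpha>: "bot < \<alpha>" and lim: "\<And>\<beta>. \<beta> < \<alpha> \<Longrightarrow> \<exists>\<gamma>>\<beta>. \<gamma> < \<alpha>" and "p < ray_of_omega1 \<alpha>"
  then have "fst (ray_coords p) < \<alpha>"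
    using snd_ray_coords(1)[of p] by (auto simp: less_long_ray_iff ray_coords_ray_of_omega1)
  then obtain \<gamma> where "fst (ray_coords p) < \<gamma>" "\<gamma> < \<alpha>" using lim by blast
  then show "\<exists>\<beta>\<in>{bot<..}. \<beta> < \<alpha> \<and> p < ray_of_omega1 \<beta>"
    using less_ray_of_omega1 by (intro bexI[of _ \<gamma>]) (auto intro: order_le_less_trans[OF bot_least])
qed simp

text \<open>Below \<open>p\<close> there are only countably many unit intervals, and each contributes its rational
  points.\<close>

lemma countable_separating_below_long_ray:
  obtains D :: "long_ray set" where "countable D"
    "\<And>x y. x < y \<Longrightarrow> y < p \<Longrightarrow> \<exists>d\<in>D. \<exists>d'\<in>D. x \<le> d \<and> d < d' \<and> d' \<le> y"
proof -
  define \<iota> where "\<iota> = (\<lambda>z. Abs_long_ray (Abs_closed_long_ray z))"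
  let ?D = "\<iota> ` ({..fst (ray_coords p)} \<times> \<rat>)"
  have "countable {..fst (ray_coords p)}"
    by (rule countable_atMost_omega1)
  then have D: "countable ?D" by (intro countable_image countable_SIGMA) (auto simp: countable_rat)
  have sep: "\<exists>d\<in>?D. \<exists>d'\<in>?D. x \<le> d \<and> d < d' \<and> d' \<le> y" if xy: "x < y" "y < p" for x y
  proof -
    obtain \<beta> t where x: "ray_coords x = (\<beta>, t)" by fastforce
    obtain \<gamma> u where y: "ray_coords y = (\<gamma>, u)" by fastforce
    have t: "0 \<le> t" "t < 1" and u: "u < 1" using snd_ray_coords[of x] snd_ray_coords[of y] x y by auto
    have \<beta>: "\<beta> \<le> fst (ray_coords p)"
      using xy x y by (auto simp: less_long_ray_iff)
    \<comment> \<open>The separating points are taken in the unit interval of \<open>x\<close>, between \<open>x\<close> and either \<open>y\<close>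
      or the end of that interval, whichever comes first.\<close>
    define v where "v = (if \<beta> < \<gamma> then 1 else u)"
    have v: "t < v" "v \<le> 1" using xy x y t u by (auto simp: v_def less_long_ray_iff)
    obtain q where q: "q \<in> \<rat>" "t < q" "q < v" using Rats_dense_in_real[OF v(1)] by blast
    obtain q' where q': "q' \<in> \<rat>" "q < q'" "q' < v" using Rats_dense_in_real[OF q(3)] by blast
    have "ray_coords (\<iota> (\<beta>, q)) = (\<beta>, q)" "ray_coords (\<iota> (\<beta>, q')) = (\<beta>, q')"
      unfolding \<iota>_def by (rule ray_coords_Abs; use t v q q' in auto)+
    then have "x < \<iota> (\<beta>, q)" "\<iota> (\<beta>, q) < \<iota> (\<beta>, q')" "\<iota> (\<beta>, q') < y"
      using x y xy q q' by (auto simp: less_long_ray_iff v_def split: if_splits)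
    moreover have "\<iota> (\<beta>, q) \<in> ?D" "\<iota> (\<beta>, q') \<in> ?D" using \<beta> q q' by auto
    ultimately show ?thesis
      by (meson less_imp_le)
  qed
  show thesis by (rule that[OF D sep])
qed

text \<open>Closure is an equaliser argument. For unboundedness, choose \<open>a\<^sub>n \<le> x\<^sub>n \<le> a\<^bsub>n+1\<^esub>\<close>
  with \<open>a\<^sub>n < f x\<^sub>n < a\<^bsub>n+1\<^esub>\<close> in the long ray. At the common limit \<open>\<alpha>\<close> of the \<open>a\<^sub>n\<close> and
  the \<open>x\<^sub>n\<close>, continuity gives \<open>f \<alpha> = \<alpha>\<close>. The point \<open>x\<^sub>n\<close> can be chosen past \<open>a\<^sub>n\<close>
  because \<open>f\<close> is bounded on the countable segment below it.\<close>

lemma club_omega1_fixed_points: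
  assumes f: "continuous_on UNIV f" and unb: "\<And>p. \<exists>\<alpha>. p < f \<alpha>"
  shows "club_omega1 {\<alpha>. bot < \<alpha> \<and> f \<alpha> = ray_of_omega1 \<alpha>}" (is "club_omega1 ?C")
proof -
  have cont: "continuous_on {bot<..} (\<lambda>\<alpha>. (f \<alpha>, ray_of_omega1 \<alpha>))"
    using f continuous_on_ray_of_omega1 by (auto intro!: continuous_intros intro: continuous_on_subset)
  have "?C = {bot<..} \<inter> (\<lambda>\<alpha>. (f \<alpha>, ray_of_omega1 \<alpha>)) -` {z. fst z = snd z}"
    by auto
  moreover have "closed {z :: long_ray \<times> long_ray. fst z = snd z}"
    by (intro closed_Collect_eq continuous_intros)
  ultimately have "closed ?C"
    using continuous_closed_preimage[OF cont closed_nonzero_omega1] by metis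
  moreover have "\<exists>\<alpha>\<in>?C. \<delta> < \<alpha>" for \<delta>
  proof -
    let ?R = "\<lambda>\<beta> \<gamma>. \<exists>x. bot < \<gamma> \<and> \<beta> \<le> x \<and> x \<le> \<gamma> \<and> ray_of_omega1 \<beta> < f x \<and> f x < ray_of_omega1 \<gamma>"
    have "\<exists>\<gamma>>\<beta>. ?R \<beta> \<gamma>" for \<beta>
    proof -
      have "countable (f ` {..<\<beta>})" using countable_lessThan_omega1 by blast
      then obtain p where p: "\<And>\<alpha>. \<alpha> < \<beta> \<Longrightarrow> f \<alpha> < p"
        using countable_bounded_long_ray by (metis imageI lessThan_iff)
      obtain x where x: "max p (ray_of_omega1 \<beta>) < f x" using unb by blast
      obtain \<gamma> where \<gamma>: "max x \<beta> < \<gamma>" "f x < ray_of_omega1 \<gamma>" using ray_of_omega1_cofinal by blast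
      have "\<beta> \<le> x" using p x by (meson max_less_iff_conj less_asym not_le)
      then show ?thesis using x \<gamma>
        by (intro exI[of _ \<gamma>]) (auto intro!: exI[of _ x] intro: order_le_less_trans[OF bot_least])
    qed
    then obtain a \<alpha> where a: "a \<longlonglongrightarrow> \<alpha>" "\<And>n. ?R (a n) (a (Suc n))" "\<delta> < \<alpha>"
      by (rule omega_chain[where \<delta> = \<delta>]) (rule that)
    from a(2) obtain x where x: "\<And>n. bot < a (Suc n) \<and> a n \<le> x n \<and> x n \<le> a (Suc n) \<and>
        ray_of_omega1 (a n) < f (x n) \<and> f (x n) < ray_of_omega1 (a (Suc n))"
      by metis
    have \<alpha>: "bot < \<alpha>" using a(3) by (rule order_le_less_trans[OF bot_least])
    have "x \<longlonglongrightarrow> \<alpha>" using x by (intro interleaved_limit[OF a(1)]) auto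
    then have "(\<lambda>n. f (x n)) \<longlonglongrightarrow> f \<alpha>"
      by (rule continuous_on_tendsto_compose[OF f]) auto
    then have 1: "(\<lambda>n. f (x (Suc n))) \<longlonglongrightarrow> f \<alpha>" by (rule LIMSEQ_Suc)
    have "(\<lambda>n. ray_of_omega1 (a (Suc n))) \<longlonglongrightarrow> ray_of_omega1 \<alpha>"
      by (rule continuous_on_tendsto_compose[OF continuous_on_ray_of_omega1 LIMSEQ_Suc[OF a(1)]])
        (use \<alpha> x in auto)
    then have "(\<lambda>n. f (x (Suc n))) \<longlonglongrightarrow> ray_of_omega1 \<alpha>"
      by (rule interleaved_limit) (use x in \<open>auto intro: less_imp_le\<close>)
    then have "f \<alpha> = ray_of_omega1 \<alpha>" using 1 LIMSEQ_unique by blast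
    then show ?thesis using \<alpha> a(3) by blast
  qed
  then have "\<not> bdd_above ?C" by (meson bdd_above.unfold not_le)
  ultimately show ?thesis by (simp add: club_omega1_def)
qed

section \<open>The circle\<close>

text \<open>The continuous injection \<open>circle_cis\<close> into the complex plane reduces separation and the
  behaviour of maps from \<open>\<omega>\<^sub>1\<close> to the corresponding facts about real coordinates.\<close>

lift_definition circle_cis :: "circle \<Rightarrow> complex" is cis
proof -
  fix x y assume "[x = y] (rmod (2 * pi))"
  then obtain n where n: "y = x + of_int n * (2 * pi)" unfolding rcong_altdef by blast
  have "cis y = cis x * cis (2 * pi * of_int n)" by (simp add: n cis_mult mult.commute)
  then show "cis x = cis y" by simp
qed

lemma inj_circle_cis: "inj circle_cis"
proof (rule injI, transfer)
  fix x y assume "cis x = cis y"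
  then have "sin x = sin y \<and> cos x = cos y" by (simp add: complex_eq_iff)
  then obtain n where "x = y + 2 * pi * of_int n" unfolding sin_cos_eq_iff by auto
  then have "[y = x] (rmod (2 * pi))" unfolding rcong_altdef by (intro exI[of _ n]) simp
  then show "[x = y] (rmod (2 * pi))" by (rule rcong_sym)
qed

lemma continuous_on_abs_circle: "continuous_on S abs_circle"
  by (rule continuous_on_subset[of UNIV]) (auto simp: continuous_on_open_vimage open_circle_def)

lemma continuous_on_circle_cis: "continuous_on S circle_cis"
proof (rule continuous_on_subset[of UNIV])
  have "open (circle_cis -` V)" if "open V" for V
  proof -
    have "abs_circle -` circle_cis -` V = cis -` V" by (auto simp: circle_cis.abs_eq)
    then show ?thesis
      using that by (simp add: open_circle_def open_vimage continuous_on_cis)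
  qed
  then show "continuous_on UNIV circle_cis" by (simp add: continuous_on_open_vimage)
qed simp

instance circle :: t2_space
proof
  fix x y :: circle assume "x \<noteq> y"
  then have ne: "circle_cis x \<noteq> circle_cis y" using inj_circle_cis by (auto dest: injD)
  obtain U V where "open U" "open V" "circle_cis x \<in> U" "circle_cis y \<in> V" "U \<inter> V = {}"
    using hausdorff[OF ne] by blast
  then show "\<exists>U V. open U \<and> open V \<and> x \<in> U \<and> y \<in> V \<and> U \<inter> V = {}"
    by (intro exI[of _ "circle_cis -` U"] exI[of _ "circle_cis -` V"])
      (auto intro: open_vimage continuous_on_circle_cis)
qed

lemma compact_UNIV_circle: "compact (UNIV :: circle set)"
proof -
  have "x \<in> abs_circle ` {0..2 * pi}" for x
  proof -
    obtain t where t: "x = abs_circle t" by (induct x rule: circle.abs_induct) blast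
    have "t rmod (2 * pi) \<in> {0..2 * pi}" by (simp add: rmod_nonneg rmod_le)
    moreover have "abs_circle (t rmod (2 * pi)) = x" using t by (simp add: circle.abs_eq_iff)
    ultimately show ?thesis by blast
  qed
  then have "abs_circle ` {0..2 * pi} = UNIV" by blast
  then show ?thesis
    using compact_continuous_image[OF continuous_on_abs_circle compact_Icc] by metis
qed

lemma circle_nontrivial: obtains \<theta> :: circle where "\<theta> \<noteq> 0"
proof -
  have "circle_cis (abs_circle pi) \<noteq> circle_cis 0"
    by (simp add: circle_cis.abs_eq zero_circle_def)
  then show thesis using that by metis
qed

lemma circle_eventually_constant:
  fixes f :: "omega1 \<Rightarrow> circle"
  assumes f: "continuous_on UNIV f"
  obtains \<gamma> c where "\<And>\<alpha>. \<gamma> < \<alpha> \<Longrightarrow> f \<alpha> = c"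
proof -
  have real: "\<exists>\<gamma> c. \<forall>\<alpha>>\<gamma>. g \<alpha> = c" if "continuous_on UNIV g" for g :: "omega1 \<Rightarrow> real"
    using eventually_constant_omega1[OF that countable_rat]
    by (metis Rats_dense_in_real less_imp_le)
  have cis: "continuous_on UNIV (\<lambda>\<alpha>. circle_cis (f \<alpha>))"
    by (rule continuous_on_compose2[OF continuous_on_circle_cis f]) auto
  obtain \<gamma>1 c1 where 1: "\<forall>\<alpha>>\<gamma>1. Re (circle_cis (f \<alpha>)) = c1"
    using real[OF continuous_on_Re[OF cis]] by blast
  obtain \<gamma>2 c2 where 2: "\<forall>\<alpha>>\<gamma>2. Im (circle_cis (f \<alpha>)) = c2"
    using real[OF continuous_on_Im[OF cis]] by blast
  obtain \<delta> where \<delta>: "max \<gamma>1 \<gamma>2 < \<delta>" using gt_ex by blast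
  have "f \<alpha> = f \<delta>" if "max \<gamma>1 \<gamma>2 < \<alpha>" for \<alpha>
    using 1 2 that \<delta> by (intro injD[OF inj_circle_cis]) (simp add: complex_eq_iff)
  then show thesis using that by blast
qed

section \<open>Circle bundles over the long ray\<close>

lemma principal_circle_bundleD:
  assumes "principal_circle_bundle \<pi> act"
  shows principal_circle_bundle_continuous: "continuous_on UNIV \<pi>"
    and principal_circle_bundle_zero: "act x 0 = x"
    and principal_circle_bundle_fibre: "\<pi> (act x \<theta>) = \<pi> x"
    and principal_circle_bundle_free: "act x \<theta> = x \<Longrightarrow> \<theta> = 0"
  using assms by (simp_all add: principal_circle_bundle_def)

lemma principal_circle_bundle_trivialisation:
  assumes "principal_circle_bundle \<pi> act"
  obtains U h g where "open U" "p \<in> U"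
    "homeomorphism (\<pi> -` U) (U \<times> (UNIV :: circle set)) h g" "\<And>x. \<pi> x \<in> U \<Longrightarrow> fst (h x) = \<pi> x"
proof -
  have "\<forall>p. \<exists>U h g. open U \<and> p \<in> U \<and> homeomorphism (\<pi> -` U) (U \<times> (UNIV :: circle set)) h g \<and>
      (\<forall>x\<in>\<pi> -` U. fst (h x) = \<pi> x)"
    using assms by (simp add: principal_circle_bundle_def)
  then show thesis using that by (meson vimageI)
qed

lemma principal_circle_bundle_surj:
  assumes "principal_circle_bundle \<pi> act"
  obtains x where "\<pi> x = p"
proof -
  obtain U h g where U: "open U" "p \<in> U"
    "homeomorphism (\<pi> -` U) (U \<times> (UNIV :: circle set)) h g" "\<And>x. \<pi> x \<in> U \<Longrightarrow> fst (h x) = \<pi> x"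
    by (rule principal_circle_bundle_trivialisation[OF assms, where p = p]) (rule that)
  from U(2,3) have "g (p, 0) \<in> \<pi> -` U" "h (g (p, 0)) = (p, 0)"
    unfolding homeomorphism_def by blast+
  then show thesis using that[of "g (p, 0)"] U(4)[of "g (p, 0)"] by simp
qed

text \<open>Points of different fibres are separated in the base, points of one fibre in a local
  trivialisation.\<close>

lemma Hausdorff_space_principal_circle_bundle:
  fixes \<pi> :: "'m::topological_space \<Rightarrow> long_ray"
  assumes B: "principal_circle_bundle \<pi> act"
  shows "Hausdorff_space (euclidean :: 'm topology)"
proof -
  have cont: "continuous_on UNIV \<pi>" by (rule principal_circle_bundle_continuous[OF B])
  have "\<exists>V W. open V \<and> open W \<and> x \<in> V \<and> y \<in> W \<and> V \<inter> W = {}" if "x \<noteq> y" for x y :: 'm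
  proof (cases "\<pi> x = \<pi> y")
    case False
    obtain V W where "open V" "open W" "\<pi> x \<in> V" "\<pi> y \<in> W" "V \<inter> W = {}"
      using hausdorff[OF False] by blast
    then show ?thesis
      by (intro exI[of _ "\<pi> -` V"] exI[of _ "\<pi> -` W"]) (auto intro: open_vimage cont)
  next
    case True
    obtain U h g where U: "open U" "\<pi> x \<in> U"
      and hom: "homeomorphism (\<pi> -` U) (U \<times> (UNIV :: circle set)) h g"
      by (rule principal_circle_bundle_trivialisation[OF B]) blast
    have h: "continuous_on (\<pi> -` U) h" "g (h x) = x" "g (h y) = y"
      using hom U True by (auto simp: homeomorphism_def)
    then have ne: "h x \<noteq> h y" using that by metis
    obtain V W where "open V" "open W" "h x \<in> V" "h y \<in> W" "V \<inter> W = {}"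
      using hausdorff[OF ne] by blast
    moreover have "open (\<pi> -` U)" using U cont by (auto intro: open_vimage)
    ultimately show ?thesis using U True h(1)
      by (intro exI[of _ "\<pi> -` U \<inter> h -` V"] exI[of _ "\<pi> -` U \<inter> h -` W"])
        (auto intro: continuous_open_preimage)
  qed
  then show ?thesis by (auto simp: Hausdorff_space_def disjnt_def)
qed

text \<open>This says that \<open>\<pi>\<close> is a closed map. It is the tube lemma in a local trivialisation, whose
  fibre, the circle, is compact.\<close>

lemma principal_circle_bundle_tube:
  assumes B: "principal_circle_bundle \<pi> act" and W: "open W" "\<pi> -` {p} \<subseteq> W"
  obtains V where "open V" "p \<in> V" "\<pi> -` V \<subseteq> W"
proof -
  obtain U h g where U: "open U" "p \<in> U"
    and hom: "homeomorphism (\<pi> -` U) (U \<times> (UNIV :: circle set)) h g"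
    and fst: "\<And>x. \<pi> x \<in> U \<Longrightarrow> fst (h x) = \<pi> x"
    by (rule principal_circle_bundle_trivialisation[OF B]) blast
  have g: "continuous_on (U \<times> UNIV) g" "\<And>z. fst z \<in> U \<Longrightarrow> h (g z) = z \<and> \<pi> (g z) \<in> U"
    and gh: "\<And>x. \<pi> x \<in> U \<Longrightarrow> g (h x) = x"
    using hom unfolding homeomorphism_def by (blast, force, blast)
  let ?W = "(U \<times> UNIV) \<inter> g -` W"
  have "open ?W" using g(1) U(1) W(1) by (intro continuous_open_preimage open_Times) auto
  moreover have "{p} \<times> UNIV \<subseteq> ?W"
  proof -
    have "g (p, \<theta>) \<in> W" for \<theta>
      using g(2)[of "(p, \<theta>)"] fst[of "g (p, \<theta>)"] W(2) U(2) by auto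
    then show ?thesis using U(2) by auto
  qed
  ultimately have "\<exists>V. p \<in> V \<and> open V \<and> V \<times> UNIV \<subseteq> ?W"
    by (rule Elementary_Topology.tube_lemma[OF compact_UNIV_circle])
  then obtain V where V: "p \<in> V" "open V" "V \<times> UNIV \<subseteq> ?W" by blast
  have "x \<in> W" if "\<pi> x \<in> V" for x
  proof -
    have "\<pi> x \<in> U" using V(3) that by blast
    then have "h x \<in> V \<times> UNIV" "g (h x) = x" using fst gh that by (auto simp: mem_Times_iff)
    then show ?thesis using V(3) by auto
  qed
  then show thesis using V by (intro that[of V]) auto
qed

text \<open>Let \<open>W\<close> be a neighbourhood of \<open>s \<alpha>\<close>. The fibre over \<open>g \<alpha>\<close> is contained in the open set
  \<open>W \<union> - E\<close>, hence so are all nearby fibres, and \<open>s\<close> takes its values in \<open>E\<close>.\<close>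

lemma continuous_on_section_of_closed:
  fixes s :: "'a::topological_space \<Rightarrow> 'm::topological_space"
  assumes B: "principal_circle_bundle \<pi> act" and E: "closed E" and g: "continuous_on UNIV g"
    and s: "\<And>\<alpha>. E \<inter> \<pi> -` {g \<alpha>} = {s \<alpha>}"
  shows "continuous_on UNIV s"
proof -
  have "(s \<longlongrightarrow> s \<alpha>) (at \<alpha>)" for \<alpha>
  proof (rule topological_tendstoI)
    fix W assume "open W" "s \<alpha> \<in> W"
    have "\<pi> -` {g \<alpha>} \<inter> E \<subseteq> W" using s[of \<alpha>] \<open>s \<alpha> \<in> W\<close> by (simp add: Int_commute)
    then have "open (W \<union> - E)" "\<pi> -` {g \<alpha>} \<subseteq> W \<union> - E"
      using E \<open>open W\<close> by auto
    then obtain V where V: "open V" "g \<alpha> \<in> V" "\<pi> -` V \<subseteq> W \<union> - E"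
      by (rule principal_circle_bundle_tube[OF B]) (rule that)
    have "(g \<longlongrightarrow> g \<alpha>) (at \<alpha>)" using g by (auto simp: continuous_on_def)
    then have "\<forall>\<^sub>F \<beta> in at \<alpha>. g \<beta> \<in> V" using V by (auto dest: topological_tendstoD)
    then show "\<forall>\<^sub>F \<beta> in at \<alpha>. s \<beta> \<in> W"
      by (rule eventually_mono) (use V s in blast)
  qed
  then show ?thesis by (simp add: continuous_on_def)
qed

text \<open>If \<open>\<pi> \<circ> k\<close> were bounded, it would be eventually a constant \<open>c\<close>; then the circle coordinate
  of \<open>k\<close> in a trivialisation around \<open>c\<close> would be eventually constant too.\<close>

lemma omega1_unbounded_in_bundle:
  fixes \<pi> :: "'m::topological_space \<Rightarrow> long_ray" and k :: "omega1 \<Rightarrow> 'm"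
  assumes B: "principal_circle_bundle \<pi> act" and k: "continuous_on UNIV k" "inj k"
  shows "\<exists>\<alpha>. p < \<pi> (k \<alpha>)"
proof (rule ccontr)
  assume "\<not> ?thesis"
  then have le: "\<pi> (k \<alpha>) \<le> p" for \<alpha> by (simp add: not_less)
  obtain \<beta> where \<beta>: "p < ray_of_omega1 \<beta>" using ray_of_omega1_cofinal by blast
  obtain D where D: "countable D"
    "\<And>x y. x < y \<Longrightarrow> y < ray_of_omega1 \<beta> \<Longrightarrow> \<exists>d\<in>D. \<exists>d'\<in>D. x \<le> d \<and> d < d' \<and> d' \<le> y"
    by (rule countable_separating_below_long_ray[where p = "ray_of_omega1 \<beta>"]) (rule that)
  have "continuous_on UNIV (\<lambda>\<alpha>. \<pi> (k \<alpha>))"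
    by (rule continuous_on_compose2[OF principal_circle_bundle_continuous[OF B] k(1)]) auto
  from this D(1) obtain \<gamma> c where c: "\<And>\<alpha>. \<gamma> < \<alpha> \<Longrightarrow> \<pi> (k \<alpha>) = c"
    by (rule eventually_constant_omega1) (rule D(2), assumption, rule le_less_trans[OF le \<beta>], rule that, blast)
  obtain U h g where U: "open U" "c \<in> U"
    and hom: "homeomorphism (\<pi> -` U) (U \<times> (UNIV :: circle set)) h g"
    and fst: "\<And>x. \<pi> x \<in> U \<Longrightarrow> fst (h x) = \<pi> x"
    by (rule principal_circle_bundle_trivialisation[OF B]) blast
  obtain \<delta> where \<delta>: "\<gamma> < \<delta>" using gt_ex by blast
  \<comment> \<open>Replacing \<open>k\<close> below \<open>\<delta>\<close> by the constant \<open>k \<delta>\<close> puts all values in one fibre while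
    leaving the tail unchanged.\<close>
  define m where "m = (\<lambda>\<alpha>. k (max \<alpha> \<delta>))"
  have m\<pi>: "\<pi> (m \<alpha>) = c" for \<alpha> using c \<delta> by (simp add: m_def less_max_iff_disj)
  have "continuous_on UNIV m" unfolding m_def
    by (rule continuous_on_compose2[OF k(1)]) (auto intro: continuous_intros)
  then have "continuous_on UNIV (\<lambda>\<alpha>. snd (h (m \<alpha>)))"
    using hom U m\<pi> by (intro continuous_on_snd continuous_on_compose2[of "\<pi> -` U" h UNIV m])
      (auto simp: homeomorphism_def)
  then obtain \<epsilon> d where d: "\<And>\<alpha>. \<epsilon> < \<alpha> \<Longrightarrow> snd (h (m \<alpha>)) = d"
    using circle_eventually_constant by blast
  obtain \<alpha> where \<alpha>: "max \<epsilon> \<delta> < \<alpha>" using gt_ex by blast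
  obtain \<alpha>' where \<alpha>': "\<alpha> < \<alpha>'" using gt_ex by blast
  have "h (m \<alpha>) = h (m \<alpha>')"
    using d[of \<alpha>] d[of \<alpha>'] \<alpha> \<alpha>' fst[of "m \<alpha>"] fst[of "m \<alpha>'"] m\<pi> U by (auto simp: prod_eq_iff)
  then have "m \<alpha> = m \<alpha>'"
    using hom U m\<pi> by (metis homeomorphism_apply1 vimageI)
  then show False using \<alpha> \<alpha>' k(2) by (auto simp: m_def max_def dest!: injD split: if_splits)
qed

text \<open>Over a bounded part of the base, \<open>k ` K\<close> is the image of a bounded closed subset of
  \<open>\<omega>\<^sub>1\<close>, which is compact, and \<open>M\<close> is Hausdorff.\<close>

lemma closed_image_omega1_in_bundle:
  assumes B: "principal_circle_bundle \<pi> act" and k: "continuous_on UNIV k"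
    and K: "closed (K :: omega1 set)" and bdd: "\<And>p. bdd_above {\<alpha>\<in>K. \<pi> (k \<alpha>) < p}"
  shows "closed (k ` K)"
proof -
  have "\<exists>W. open W \<and> x \<in> W \<and> W \<subseteq> - k ` K" if x: "x \<notin> k ` K" for x
  proof -
    obtain \<beta>' where \<beta>': "\<pi> x < ray_of_omega1 \<beta>'" using ray_of_omega1_cofinal by blast
    obtain \<beta> where \<beta>: "\<And>\<alpha>. \<alpha> \<in> K \<Longrightarrow> \<pi> (k \<alpha>) < ray_of_omega1 \<beta>' \<Longrightarrow> \<alpha> \<le> \<beta>"
      using bdd[of "ray_of_omega1 \<beta>'"] by (auto simp: bdd_above_def)
    have "compact (k ` ({..\<beta>} \<inter> K))"
      using k K compact_atMost_omega1
      by (intro compact_continuous_image compact_Int_closed) (auto intro: continuous_on_subset)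
    then have "closed (k ` ({..\<beta>} \<inter> K))"
      using compactin_imp_closedin[OF Hausdorff_space_principal_circle_bundle[OF B]] by auto
    moreover have "open (\<pi> -` {..<ray_of_omega1 \<beta>'})"
      using principal_circle_bundle_continuous[OF B] by (auto intro: open_vimage)
    ultimately show ?thesis using x \<beta>' \<beta>
      by (intro exI[of _ "\<pi> -` {..<ray_of_omega1 \<beta>'} - k ` ({..\<beta>} \<inter> K)"]) auto
  qed
  then show ?thesis unfolding closed_def by (intro topological_space_class.openI) simp
qed

lemma has_order_1_iff:
  "has_order \<pi> act 1 \<longleftrightarrow> \<not> order_infinite \<pi> \<and> has_periodic_club \<pi> act 1"
  by (auto simp: one_enat_def)

text \<open>For \<open>n = 1\<close> the only rotation involved is trivial, so the periodicity condition says just that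
  the fibre of \<open>E\<close> is a singleton.\<close>

lemma has_periodic_club_1_iff:
  assumes B: "principal_circle_bundle \<pi> act"
  shows "has_periodic_club \<pi> act 1 \<longleftrightarrow> (\<exists>E C. club_bundle \<pi> E \<and> club_omega1 C \<and>
    (\<forall>\<alpha>\<in>C. \<exists>x. E \<inter> \<pi> -` {ray_of_omega1 \<alpha>} = {x}))"
proof -
  have "{act x (abs_circle (2 * pi * real k / real 1)) | k. k < 1} = {x}" for x
    using principal_circle_bundle_zero[OF B, of x] by (auto simp: zero_circle_def)
  then have "card F = Suc 0 \<and> (\<forall>x\<in>F. F = {act x (abs_circle (2 * pi * real k / real 1)) | k. k < 1})
      \<longleftrightarrow> (\<exists>x. F = {x})" for F
    unfolding card_1_singleton_iff by blast
  then show ?thesis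
    unfolding has_periodic_club_def Let_def by simp
qed

lemma omega1_copy_of_periodic_club:
  fixes \<pi> :: "'m::topological_space \<Rightarrow> long_ray"
  assumes B: "principal_circle_bundle \<pi> act" and "has_periodic_club \<pi> act 1"
  shows "\<exists>S :: 'm set. S homeomorphic (UNIV :: omega1 set)"
proof -
  obtain E C s where E: "closed E" and C: "closed C" "\<not> bdd_above C" "bot \<notin> C"
    and s: "\<And>\<alpha>. \<alpha> \<in> C \<Longrightarrow> E \<inter> \<pi> -` {ray_of_omega1 \<alpha>} = {s \<alpha>}"
    using assms(2) unfolding has_periodic_club_1_iff[OF B] club_bundle_def club_omega1_def by metis
  let ?e = "club_enum C"
  let ?g = "\<lambda>\<alpha>. ray_of_omega1 (?e \<alpha>)"
  have pos: "bot < ?e \<alpha>" for \<alpha>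
    using club_enum(1)[OF C(1,2), of \<alpha>] C(3) by (metis bot.not_eq_extremum)
  have g: "continuous_on UNIV ?g"
    by (rule continuous_on_compose2[OF continuous_on_ray_of_omega1 club_enum(3)[OF C(1,2)]])
      (use pos in auto)
  have se: "E \<inter> \<pi> -` {?g \<alpha>} = {s (?e \<alpha>)}" for \<alpha> using s club_enum(1)[OF C(1,2)] by blast
  have "\<pi> \<circ> (\<lambda>\<alpha>. s (?e \<alpha>)) = ?g" using se by fastforce
  moreover have "strict_mono ?g"
    using strict_monoD[OF club_enum(2)[OF C(1,2)]] pos
    by (intro strict_monoI) (simp add: ray_of_omega1_less_iff)
  ultimately have "range (\<lambda>\<alpha>. s (?e \<alpha>)) homeomorphic (UNIV :: omega1 set)"
    using continuous_on_section_of_closed[OF B E g se] principal_circle_bundle_continuous[OF B]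
    by (intro range_homeomorphic_omega1) auto
  then show ?thesis by blast
qed

lemma order_1_of_omega1_copy:
  fixes \<pi> :: "'m::topological_space \<Rightarrow> long_ray" and k :: "omega1 \<Rightarrow> 'm"
  assumes B: "principal_circle_bundle \<pi> act" and k: "continuous_on UNIV k" "inj k"
  shows "has_order \<pi> act 1"
proof -
  define C where "C = {\<alpha>. bot < \<alpha> \<and> \<pi> (k \<alpha>) = ray_of_omega1 \<alpha>}"
  have \<pi>k: "continuous_on UNIV (\<lambda>\<alpha>. \<pi> (k \<alpha>))"
    by (rule continuous_on_compose2[OF principal_circle_bundle_continuous[OF B] k(1)]) auto
  have C: "club_omega1 C"
    unfolding C_def
    by (rule club_omega1_fixed_points[OF \<pi>k]) (rule omega1_unbounded_in_bundle[OF B k])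
  define E where "E = k ` C"
  have fibre: "E \<inter> \<pi> -` {ray_of_omega1 \<alpha>} = {k \<alpha>}" if "\<alpha> \<in> C" for \<alpha>
    using that by (auto simp: E_def C_def ray_of_omega1_eq_iff)
  have "bdd_above {\<alpha>\<in>C. \<pi> (k \<alpha>) < p}" for p
  proof -
    obtain \<beta> where \<beta>: "bot < \<beta>" "p < ray_of_omega1 \<beta>" using ray_of_omega1_cofinal by blast
    have "\<alpha> \<le> \<beta>" if "\<alpha> \<in> C" "\<pi> (k \<alpha>) < p" for \<alpha>
      using that \<beta> by (auto simp: C_def intro!: less_imp_le dest: less_trans simp: ray_of_omega1_less_iff)
    then show ?thesis by (intro bdd_aboveI[of _ \<beta>]) auto
  qed
  then have "closed E"
    unfolding E_def using C
    by (intro closed_image_omega1_in_bundle[OF B k(1)]) (auto simp: club_omega1_def)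
  moreover have "\<not> bdd_above (\<pi> ` E)"
  proof
    assume "bdd_above (\<pi> ` E)"
    then obtain p where p: "\<And>\<alpha>. \<alpha> \<in> C \<Longrightarrow> ray_of_omega1 \<alpha> \<le> p"
      by (auto simp: bdd_above_def E_def C_def)
    obtain \<beta> where \<beta>: "bot < \<beta>" "p < ray_of_omega1 \<beta>" using ray_of_omega1_cofinal by blast
    have "\<alpha> \<le> \<beta>" if "\<alpha> \<in> C" for \<alpha>
      using p[OF that] \<beta> that ray_of_omega1_less_iff[of \<alpha> \<beta>] by (auto simp: C_def)
    then show False using C by (auto simp: club_omega1_def bdd_above_def)
  qed
  ultimately have club: "club_bundle \<pi> E" by (simp add: club_bundle_def)
  \<comment> \<open>The set \<open>E\<close> contains at most one point of each fibre, but a nontrivial rotation moves every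
    point within its fibre.\<close>
  have "\<not> order_infinite \<pi>"
  proof
    assume "order_infinite \<pi>"
    then obtain C' where C': "club_omega1 C'" "\<pi> -` ray_of_omega1 ` C' \<subseteq> E"
      using club by (auto simp: order_infinite_def)
    then obtain \<alpha> where \<alpha>: "\<alpha> \<in> C'" by (metis club_omega1_def bdd_above_empty ex_in_conv)
    obtain x where x: "\<pi> x = ray_of_omega1 \<alpha>" using principal_circle_bundle_surj[OF B] by blast
    obtain \<theta> :: circle where \<theta>: "\<theta> \<noteq> 0" using circle_nontrivial by blast
    have "x \<in> E" "act x \<theta> \<in> E"
      using C'(2) x \<alpha> principal_circle_bundle_fibre[OF B] by auto
    moreover have "\<pi> (act x \<theta>) = \<pi> x" using principal_circle_bundle_fibre[OF B] .
    ultimately have "act x \<theta> = x"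
      by (auto simp: E_def C_def ray_of_omega1_eq_iff)
    then show False using principal_circle_bundle_free[OF B] \<theta> by blast
  qed
  moreover have "has_periodic_club \<pi> act 1"
    unfolding has_periodic_club_1_iff[OF B] using club C fibre by blast
  ultimately show ?thesis by (simp add: has_order_1_iff del: has_order.simps)
qed

theorem lemma2p16:
  fixes \<pi> :: "'m::topological_space \<Rightarrow> long_ray"
    and act :: "'m \<Rightarrow> circle \<Rightarrow> 'm"
  assumes "principal_circle_bundle \<pi> act"
  shows "(\<exists>S :: 'm set. S homeomorphic (UNIV :: omega1 set)) \<longleftrightarrow> has_order \<pi> act 1"
proof
  assume "\<exists>S :: 'm set. S homeomorphic (UNIV :: omega1 set)"
  then obtain S :: "'m set" and h k where "homeomorphism S (UNIV :: omega1 set) h k"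
    unfolding homeomorphic_def by blast
  then have "continuous_on UNIV k" "inj k"
    by (auto simp: homeomorphism_def intro: inj_on_inverseI[of _ h])
  then show "has_order \<pi> act 1" by (rule order_1_of_omega1_copy[OF assms])
next
  assume "has_order \<pi> act 1"
  then show "\<exists>S :: 'm set. S homeomorphic (UNIV :: omega1 set)"
    using omega1_copy_of_periodic_club[OF assms] has_order_1_iff by blast
qed

end
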